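(* Let $A\in\mathbb{R}^{m\times n}$ and $L\subseteq\{1,\dots,m\}$. Then for all $b\in\mathbb{R}^m$ such that $P_{A,b}:=\{x\in\mathbb{R}^n:Ax\le b\}\neq\emptyset$ and all $u\in\{x\in\mathbb{R}^n:A_{L^c}x\le b_{L^c}\}$ $$\mathrm{dist}(u,P_{A,b})\le H(A\vert L)\cdot\mathrm{dist}_L(b,Au+\mathbb{R}^m_+)\le H(A\vert L)\cdot\|(A_Lu-b_L)_+\|.$$ Furthermore, the first bound is tight: if $H(A\vert L)>0$ then there exist $b\in\mathbb{R}^m$ such that $P_{A,b}\neq\emptyset$ and $u\in\{x\in\mathbb{R}^n:A_{L^c}x\le b_{L^c}\}\setminus P_{A,b}$ such that $$\mathrm{dist}(u,P_{A,b})=H(A\vert L)\cdot\mathrm{dist}_L(b,Au+\mathbb{R}^m_+).$$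
   Context: $\mathbb{R}^n$ and $\mathbb{R}^m$ are each endowed with an arbitrary norm $\|\cdot\|$. For $L\subseteq\{1,\dots,m\}$, $L^c=\{1,\dots,m\}\setminus L$; $\mathbb{R}^L$ is identified with the subspace $\{y\in\mathbb{R}^m:y_{L^c}=0\}$ and carries the norm inherited from $\mathbb{R}^m$ (norm of the extension by zero). $\mathrm{dist}(u,S)=\inf\{\|u-x\|:x\in S\}$; $(y)_+=\max(0,y)$ componentwise; vector inequalities are componentwise. For $b\in\mathbb{R}^m$ and $S\subseteq\mathbb{R}^m$, $\mathrm{dist}_L(b,S)=\inf\{\|b-y\|:y\in S,\ (b-y)_{L^c}=0\}$. For $J\subseteq\{1,\dots,m\}$, $A_J\in\mathbb{R}^{J\times n}$ is the submatrix of rows of $A$ in $J$ and $b_J$ the subvector of $b$ indexed by $J$. $J$ is $A$-surjective if $A_J\mathbb{R}^n+\mathbb{R}^J_+=\mathbb{R}^J$, and $\mathcal{S}(A)=\{J\subseteq\{1,\dots,m\}:J\text{ is }A\text{-surjective}\}$. Define $$H(A\vert L)=\max_{J\in\mathcal{S}(A)}H_J(A\vert L),\qquad H_J(A\vert L)=\max_{y\in\mathbb{R}^L,\ \|y\|\le1}\ \min_{x\in\mathbb{R}^n,\ A_Jx\le y_J}\|x\|,$$ where $y_j=0$ whenever $j\in J\setminus L$; in particular $H_J(A\vert L)=0$ if $J\cap L=\emptyset$. *)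

theory Defs
  imports "HOL-Analysis.Analysis"
begin

text \<open>The norms on the two spaces are arbitrary functions satisfying the following axioms, not the
  (Euclidean) type-class \<^const>\<open>norm\<close>.\<close>

definition is_norm :: "('a::real_vector \<Rightarrow> real) \<Rightarrow> bool" where
  "is_norm N \<longleftrightarrow>
     (\<forall>x. 0 \<le> N x) \<and>
     (\<forall>x. N x = 0 \<longleftrightarrow> x = 0) \<and>
     (\<forall>c x. N (c *\<^sub>R x) = \<bar>c\<bar> * N x) \<and>
     (\<forall>x y. N (x + y) \<le> N x + N y)"

definition dist_to :: "('a::real_vector \<Rightarrow> real) \<Rightarrow> 'a \<Rightarrow> 'a set \<Rightarrow> real" where
  "dist_to N u S = (INF x\<in>S. N (u - x))"

text \<open>For an index set \<open>J\<close>, the space of vectors indexed by \<open>J\<close> is the subspace of vectors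
  vanishing off \<open>J\<close>, and the subvector indexed by \<open>J\<close> is identified with its extension by zero.
  In particular a norm on the whole space restricts to the inherited norm.\<close>

definition coord_space :: "'m set \<Rightarrow> (real ^ 'm) set" where
  "coord_space J = {y. \<forall>i. i \<notin> J \<longrightarrow> y $ i = 0}"

definition subvec :: "'m set \<Rightarrow> real ^ 'm \<Rightarrow> real ^ 'm" where
  "subvec J y = (\<chi> i. if i \<in> J then y $ i else 0)"

definition pos_part_vec :: "real ^ 'm \<Rightarrow> real ^ 'm" where
  "pos_part_vec y = (\<chi> i. max 0 (y $ i))"

definition dist_on :: "(real ^ 'm \<Rightarrow> real) \<Rightarrow> 'm set \<Rightarrow> real ^ 'm \<Rightarrow> (real ^ 'm) set \<Rightarrow> real" where
  "dist_on N L b S = (INF y\<in>{y \<in> S. subvec (- L) (b - y) = 0}. N (b - y))"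

text \<open>The solution set of \<open>A\<^sub>J x \<le> b\<^sub>J\<close>; the order on vectors is the componentwise one.\<close>

definition sol_set :: "real ^ 'n ^ 'm \<Rightarrow> 'm set \<Rightarrow> real ^ 'm \<Rightarrow> (real ^ 'n) set" where
  "sol_set A J b = {x. subvec J (A *v x) \<le> subvec J b}"

definition polyhedron_of :: "real ^ 'n ^ 'm \<Rightarrow> real ^ 'm \<Rightarrow> (real ^ 'n) set" where
  "polyhedron_of A b = {x. A *v x \<le> b}"

definition A_surjective :: "real ^ 'n ^ 'm \<Rightarrow> 'm set \<Rightarrow> bool" where
  "A_surjective A J \<longleftrightarrow>
     {subvec J (A *v x) + s | x s. s \<in> coord_space J \<and> 0 \<le> s} = coord_space J"

definition surjective_sets :: "real ^ 'n ^ 'm \<Rightarrow> 'm set set" where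
  "surjective_sets A = {J. A_surjective A J}"

text \<open>For surjective \<open>J\<close> the inner feasible set is nonempty and closed, and the minimum and
  maximum are attained, so they are the infimum and supremum below. The outer maximum is over a
  finite family containing the empty set.\<close>

definition hoffman_set ::
  "(real ^ 'n \<Rightarrow> real) \<Rightarrow> (real ^ 'm \<Rightarrow> real) \<Rightarrow> real ^ 'n ^ 'm \<Rightarrow> 'm set \<Rightarrow> 'm set \<Rightarrow> real" where
  "hoffman_set Nn Nm A L J =
     (SUP y\<in>{y \<in> coord_space L. Nm y \<le> 1}. INF x\<in>sol_set A J y. Nn x)"

definition hoffman ::
  "(real ^ 'n \<Rightarrow> real) \<Rightarrow> (real ^ 'm \<Rightarrow> real) \<Rightarrow> real ^ 'n ^ 'm \<Rightarrow> 'm set \<Rightarrow> real" where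
  "hoffman Nn Nm A L = Max (hoffman_set Nn Nm A L ` surjective_sets A)"

end

theory Submission
  imports Defs
begin

text \<open>Write \<open>b = A u + s + y\<close> with \<open>s \<ge> 0\<close> and \<open>y\<close> supported on \<open>L\<close>. Moving \<open>u\<close> into the
  polyhedron means solving \<open>A x \<le> y + s\<close> with \<open>x\<close> as short as possible. If the ball of radius
  \<open>r\<close> contains no solution, a hyperplane strictly separates the image of the ball from the orthant
  below \<open>y + s\<close>; its normal \<open>v\<close> is nonnegative and certifies that already the single inequality
  \<open>v \<bullet> A x \<le> v \<bullet> (y + s)\<close> is violated on the whole ball. Among all such certificates take one
  with smallest support \<open>J\<close>. Then \<open>J\<close> is surjective: otherwise Gordan's alternative gives a
  nonzero \<open>w \<ge> 0\<close> supported on \<open>J\<close> that annihilates the range of \<open>A\<close>, and since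
  \<open>A x \<le> y + s\<close> is solvable, subtracting a multiple of \<open>w\<close> from \<open>v\<close> shrinks the support but
  keeps a certificate (lemma \<open>surjective_infeasibility_certificate\<close>). For surjective \<open>J\<close> the system
  \<open>A\<^sub>J x \<le> y\<^sub>J\<close> has a solution of norm at most \<open>H\<^sub>J\<close> times the norm of \<open>y\<close>
  (lemma \<open>sol_set_short_solution\<close>), and since \<open>s \<ge> 0\<close> such an \<open>x\<close> satisfies the single
  inequality. Hence \<open>r\<close> is smaller than \<open>H\<close> times the norm of \<open>y\<close>, which is the
  first bound. The second bound is the choice of \<open>y\<close> as minus the positive part of the residual.

  For tightness, the least norm of a solution of \<open>A\<^sub>J x \<le> y\<^sub>J\<close> is a finite convex function of
  \<open>y\<close>, hence continuous, so the maximum defining \<open>H\<^sub>J\<close> is attained at some \<open>y\<close>. With \<open>J\<close> optimal,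
  take \<open>u = 0\<close> and let \<open>b\<close> agree with \<open>y\<close> on \<open>J\<close> and be so large elsewhere that the other rows
  neither exclude the shortest solution nor affect the distance on the right-hand side.\<close>

section \<open>Arbitrary norms on Euclidean space\<close>

lemma is_norm_minus:
  assumes "is_norm N" shows "N (- x) = N x"
proof -
  have "N ((-1) *\<^sub>R x) = \<bar>-1\<bar> * N x" using assms unfolding is_norm_def by blast
  thus ?thesis by simp
qed

lemma is_norm_bdd_below:
  assumes "is_norm N" shows "bdd_below ((\<lambda>x. N (f x)) ` S)"
  using assms by (intro bdd_belowI[where m = 0]) (auto simp: is_norm_def)

lemma is_norm_convex_combination:
  assumes "is_norm N" "0 \<le> s" "0 \<le> t"
  shows "N (s *\<^sub>R x + t *\<^sub>R y) \<le> s * N x + t * N y"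
proof -
  have "N (s *\<^sub>R x + t *\<^sub>R y) \<le> N (s *\<^sub>R x) + N (t *\<^sub>R y)"
    using assms unfolding is_norm_def by blast
  also have "\<dots> = s * N x + t * N y" using assms unfolding is_norm_def by simp
  finally show ?thesis .
qed

lemma is_norm_continuous_on:
  fixes N :: "'a::euclidean_space \<Rightarrow> real"
  assumes "is_norm N" shows "continuous_on S N"
proof -
  have "convex_on UNIV N"
    by (intro convex_onI) (simp_all add: is_norm_convex_combination[OF assms])
  hence "continuous_on UNIV N" by (intro convex_on_continuous) auto
  thus ?thesis using continuous_on_subset by blast
qed

lemma is_norm_compact_cball:
  fixes N :: "'a::euclidean_space \<Rightarrow> real"
  assumes "is_norm N" shows "compact {x. N x \<le> r}"
proof -
  \<comment> \<open>The positive minimum \<open>c\<close> on the unit sphere bounds the Euclidean norm by \<open>N x / c\<close>.\<close>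
  obtain c where c: "c > 0" "\<And>x. norm x = 1 \<Longrightarrow> c \<le> N x"
  proof -
    obtain b :: 'a where "b \<in> Basis" using nonempty_Basis by blast
    hence "sphere (0::'a) 1 \<noteq> {}" by (auto intro!: exI[of _ b])
    from continuous_attains_inf[OF compact_sphere this is_norm_continuous_on[OF assms]]
    obtain z where z: "z \<in> sphere 0 1" "\<forall>y\<in>sphere 0 1. N z \<le> N y" by blast
    have "z \<noteq> 0" using z(1) by auto
    hence "N z > 0" using assms unfolding is_norm_def by (metis order_le_less)
    with z show ?thesis by (intro that[of "N z"]) auto
  qed
  have "norm x \<le> r / c" if "N x \<le> r" for x
  proof (cases "x = 0")
    case True
    moreover have "N x \<ge> 0" using assms unfolding is_norm_def by blast
    ultimately show ?thesis using that c by simp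
  next
    case False
    have "c \<le> N ((1 / norm x) *\<^sub>R x)" using False by (intro c) simp
    also have "\<dots> = N x / norm x" using assms unfolding is_norm_def by simp
    finally show ?thesis using that False c by (simp add: field_simps)
  qed
  hence "bounded {x. N x \<le> r}" unfolding bounded_iff by blast
  moreover have "closed {x. N x \<le> r}"
    by (intro closed_Collect_le continuous_intros is_norm_continuous_on[OF assms])
  ultimately show ?thesis by (simp add: compact_eq_bounded_closed)
qed

section \<open>Surjective index sets and Gordan's alternative\<close>

lemma sol_set_iff: "x \<in> sol_set A J b \<longleftrightarrow> (\<forall>i\<in>J. (A *v x) $ i \<le> b $ i)"
  by (auto simp: sol_set_def subvec_def less_eq_vec_def)

lemma polyhedron_of_iff: "x \<in> polyhedron_of A b \<longleftrightarrow> (\<forall>i. (A *v x) $ i \<le> b $ i)"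
  by (auto simp: polyhedron_of_def less_eq_vec_def)

lemma A_surjective_iff: "A_surjective A J \<longleftrightarrow> (\<forall>y. sol_set A J y \<noteq> {})"
proof
  assume surj: "A_surjective A J"
  show "\<forall>y. sol_set A J y \<noteq> {}"
  proof
    fix y
    have "subvec J y \<in> coord_space J" by (simp add: coord_space_def subvec_def)
    then obtain x s where "subvec J y = subvec J (A *v x) + s" "0 \<le> s"
      using surj unfolding A_surjective_def by blast
    hence "x \<in> sol_set A J y" by (simp add: sol_set_def)
    thus "sol_set A J y \<noteq> {}" by blast
  qed
next
  assume ne: "\<forall>y. sol_set A J y \<noteq> {}"
  have "\<exists>x s. y = subvec J (A *v x) + s \<and> s \<in> coord_space J \<and> 0 \<le> s"
    if y: "y \<in> coord_space J" for y
  proof -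
    obtain x where "x \<in> sol_set A J y" using ne by blast
    with y show ?thesis
      by (intro exI[of _ x] exI[of _ "y - subvec J (A *v x)"])
        (auto simp: sol_set_iff coord_space_def subvec_def less_eq_vec_def)
  qed
  thus "A_surjective A J"
    unfolding A_surjective_def by (fastforce simp: coord_space_def subvec_def)
qed

text \<open>A strictly negative image can be scaled below any given right-hand side.\<close>

lemma A_surjective_if_strictly_feasible:
  fixes A :: "real ^ 'n ^ 'm"
  assumes "\<And>i. i \<in> J \<Longrightarrow> (A *v x) $ i < 0"
  shows "A_surjective A J"
  unfolding A_surjective_iff
proof
  fix y :: "real ^ 'm"
  define t where "t = (\<Sum>i\<in>J. \<bar>y $ i / (A *v x) $ i\<bar>)"
  have "t * (A *v x) $ i \<le> y $ i" if i: "i \<in> J" for i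
  proof -
    have "\<bar>y $ i / (A *v x) $ i\<bar> \<le> t"
      unfolding t_def by (rule member_le_sum) (use i in auto)
    hence "y $ i / (A *v x) $ i \<le> t" by linarith
    thus ?thesis using assms[OF i] by (simp add: field_simps)
  qed
  hence "t *\<^sub>R x \<in> sol_set A J y"
    by (simp add: sol_set_iff matrix_vector_mult_scaleR)
  thus "sol_set A J y \<noteq> {}" by blast
qed

lemma nonneg_if_bdd_below_on_ray:
  fixes p q r :: real
  assumes "\<And>t. t > 0 \<Longrightarrow> r \<le> p + t * q"
  shows "q \<ge> 0"
proof (rule ccontr)
  assume q: "\<not> q \<ge> 0"
  define t where "t = (\<bar>r - p\<bar> + 1) / (- q)"
  have "t > 0" "t * q = - (\<bar>r - p\<bar> + 1)" using q by (auto simp: t_def divide_simps)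
  with assms[of t] show False by linarith
qed

text \<open>One half of Gordan's alternative. If no \<open>A x\<close> is strictly negative on \<open>J\<close>, then the origin
  lies outside the convex set of all \<open>A x + s\<close> with \<open>s\<close> positive on \<open>J\<close> and arbitrary off \<open>J\<close>.
  The normal of a separating hyperplane vanishes off \<open>J\<close>, since the set is invariant in those
  directions, and is nonnegative on \<open>J\<close>.\<close>

lemma not_A_surjective_multiplier:
  fixes A :: "real ^ 'n ^ 'm"
  assumes "\<not> A_surjective A J"
  obtains w where "w \<noteq> 0" "0 \<le> w" "\<And>i. i \<notin> J \<Longrightarrow> w $ i = 0" "\<And>x. w \<bullet> (A *v x) = 0"
proof -
  define P where "P = {s :: real ^ 'm. \<forall>i\<in>J. s $ i > 0}"
  define R where "R = range ((*v) A)"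
  have "convex P"
    unfolding convex_def P_def
    by (auto, smt (verit) mult_nonneg_nonneg mult_pos_pos)
  moreover have "convex R"
    unfolding R_def by (intro convex_linear_image matrix_vector_mul_linear) simp
  ultimately have "convex (\<Union>x\<in>R. \<Union>y\<in>P. {x + y})"
    by (rule convex_sums[rotated])
  moreover have "0 \<notin> (\<Union>x\<in>R. \<Union>y\<in>P. {x + y})"
  proof
    assume "0 \<in> (\<Union>x\<in>R. \<Union>y\<in>P. {x + y})"
    then obtain x s where s: "0 = A *v x + s" "s \<in> P" by (auto simp: R_def)
    have "(A *v x) $ i < 0" if "i \<in> J" for i
    proof -
      have "(A *v x) $ i + s $ i = 0" using s(1) by (metis vector_add_component zero_index)
      moreover have "s $ i > 0" using s(2) that by (simp add: P_def)
      ultimately show ?thesis by linarith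
    qed
    from A_surjective_if_strictly_feasible[OF this] assms show False by blast
  qed
  ultimately obtain w where w: "w \<noteq> 0"
    "\<forall>z\<in>(\<Union>x\<in>R. \<Union>y\<in>P. {x + y}). 0 \<le> w \<bullet> z"
    by (meson separating_hyperplane_set_0)
  have sep: "0 \<le> w \<bullet> (A *v x) + w \<bullet> s" if "s \<in> P" for x s
  proof -
    have "A *v x + s \<in> (\<Union>x\<in>R. \<Union>y\<in>P. {x + y})" using that unfolding R_def by blast
    from bspec[OF w(2) this] show ?thesis by (simp add: inner_add_right)
  qed
  have one: "(\<chi> i. 1) \<in> P" by (simp add: P_def)
  have axis: "w \<bullet> axis i c = c * w $ i" for i c by (simp add: inner_axis)
  have nonneg: "w $ i \<ge> 0" for i
  proof (rule nonneg_if_bdd_below_on_ray)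
    fix t :: real assume "t > 0"
    hence "(\<chi> i. 1) + axis i t \<in> P" by (auto simp: P_def axis_def intro: add_pos_nonneg)
    from sep[OF this, of 0] show "0 \<le> w \<bullet> (\<chi> i. 1) + t * w $ i"
      by (simp add: inner_add_right axis)
  qed
  have "w $ i = 0" if "i \<notin> J" for i
  proof -
    have "- w $ i \<ge> 0"
    proof (rule nonneg_if_bdd_below_on_ray)
      fix t :: real assume "t > 0"
      have "(\<chi> i. 1) + axis i (- t) \<in> P" using that by (auto simp: P_def axis_def)
      from sep[OF this, of 0] show "0 \<le> w \<bullet> (\<chi> i. 1) + t * (- w $ i)"
        by (simp add: inner_add_right axis)
    qed
    with nonneg[of i] show ?thesis by simp
  qed
  moreover have ge: "w \<bullet> (A *v x) \<ge> 0" for x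
  proof (rule nonneg_if_bdd_below_on_ray)
    fix t :: real
    from sep[OF one, of "t *\<^sub>R x"] show "0 \<le> w \<bullet> (\<chi> i. 1) + t * (w \<bullet> (A *v x))"
      by (simp add: matrix_vector_mult_scaleR add.commute)
  qed
  have "w \<bullet> (A *v x) = 0" for x
    using ge[of x] ge[of "(-1) *\<^sub>R x"] unfolding matrix_vector_mult_scaleR by simp
  ultimately show ?thesis using that[of w] w(1) nonneg by (auto simp: less_eq_vec_def)
qed

section \<open>Solutions of least norm\<close>

lemma sol_set_closed: "closed (sol_set A J y)"
proof -
  have "sol_set A J y = (\<Inter>i\<in>J. {x. (A *v x) $ i \<le> y $ i})" by (auto simp: sol_set_iff)
  also have "closed \<dots>"
    by (intro closed_INT ballI closed_Collect_le continuous_intros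
        linear_continuous_on matrix_vector_mul_bounded_linear)
  finally show ?thesis .
qed

text \<open>Surjectivity provides some solution, and the solutions no longer than that one form a compact
  set.\<close>

lemma sol_set_least_norm:
  assumes "is_norm N" "A_surjective A J"
  obtains x where "x \<in> sol_set A J y" "N x = (INF x\<in>sol_set A J y. N x)"
proof -
  obtain x0 where x0: "x0 \<in> sol_set A J y" using assms(2) A_surjective_iff by blast
  have "compact (sol_set A J y \<inter> {x. N x \<le> N x0})"
    by (intro closed_Int_compact sol_set_closed is_norm_compact_cball assms)
  moreover have "sol_set A J y \<inter> {x. N x \<le> N x0} \<noteq> {}" using x0 by blast
  ultimately obtain x where x: "x \<in> sol_set A J y" "N x \<le> N x0"
    "\<forall>z\<in>sol_set A J y \<inter> {x. N x \<le> N x0}. N x \<le> N z"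
    using continuous_attains_inf[OF _ _ is_norm_continuous_on[OF assms(1)],
        of "sol_set A J y \<inter> {x. N x \<le> N x0}"] by auto
  have "N x \<le> N z" if "z \<in> sol_set A J y" for z
    using x that by (cases "N z \<le> N x0") auto
  hence "(INF x\<in>sol_set A J y. N x) = N x"
    using x(1) by (intro cInf_eq_minimum) auto
  with x(1) that show ?thesis by simp
qed

text \<open>Convex combinations of solutions solve the convex combination of the right-hand sides, so the
  least norm is a convex function of the right-hand side; being finite everywhere, it is
  continuous.\<close>

lemma least_norm_continuous:
  fixes A :: "real ^ 'n ^ 'm"
  assumes N: "is_norm N" and J: "A_surjective A J"
  shows "continuous_on UNIV (\<lambda>y. INF x\<in>sol_set A J y. N x)"
proof (intro convex_on_continuous convex_onI)
  fix t :: real and y z :: "real ^ 'm"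
  assume t: "0 < t" "t < 1"
  obtain x where x: "x \<in> sol_set A J y" "N x = (INF x\<in>sol_set A J y. N x)"
    using sol_set_least_norm[OF N J] by blast
  obtain x' where x': "x' \<in> sol_set A J z" "N x' = (INF x\<in>sol_set A J z. N x)"
    using sol_set_least_norm[OF N J] by blast
  let ?x = "(1 - t) *\<^sub>R x + t *\<^sub>R x'"
  have "?x \<in> sol_set A J ((1 - t) *\<^sub>R y + t *\<^sub>R z)"
    using x(1) x'(1) t
    by (auto simp: sol_set_iff matrix_vector_right_distrib matrix_vector_mult_scaleR
        intro!: add_mono mult_left_mono)
  hence "(INF x\<in>sol_set A J ((1 - t) *\<^sub>R y + t *\<^sub>R z). N x) \<le> N ?x"
    using is_norm_bdd_below[OF N, of "\<lambda>x. x"] by (intro cINF_lower) auto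
  also have "\<dots> \<le> (1 - t) * N x + t * N x'"
    using t by (intro is_norm_convex_combination N) auto
  finally show "(INF x\<in>sol_set A J ((1 - t) *\<^sub>R y + t *\<^sub>R z). N x)
      \<le> (1 - t) * (INF x\<in>sol_set A J y. N x) + t * (INF x\<in>sol_set A J z. N x)"
    by (simp add: x x')
qed auto

text \<open>Attainment has two uses: it makes the supremum of reals in \<^const>\<open>hoffman_set\<close> an upper
  bound, and its maximizer is the right-hand side of the extremal instance.\<close>

lemma hoffman_set_attained:
  fixes A :: "real ^ 'n ^ 'm"
  assumes Nn: "is_norm Nn" and Nm: "is_norm Nm" and J: "A_surjective A J"
  obtains y where "y \<in> coord_space L" "Nm y \<le> 1"
    "(INF x\<in>sol_set A J y. Nn x) = hoffman_set Nn Nm A L J"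
    "\<And>z. z \<in> coord_space L \<Longrightarrow> Nm z \<le> 1 \<Longrightarrow>
       (INF x\<in>sol_set A J z. Nn x) \<le> hoffman_set Nn Nm A L J"
proof -
  let ?B = "{y \<in> coord_space L. Nm y \<le> 1}"
  have "closed (coord_space L)"
  proof -
    have "coord_space L = (\<Inter>i\<in>-L. {y :: real ^ 'm. y $ i = 0})" by (auto simp: coord_space_def)
    also have "closed \<dots>" by (intro closed_INT ballI closed_Collect_eq continuous_intros)
    finally show ?thesis .
  qed
  hence "compact (coord_space L \<inter> {y. Nm y \<le> 1})"
    by (intro closed_Int_compact is_norm_compact_cball Nm)
  hence "compact ?B" by (simp add: Collect_conj_eq)
  moreover have "?B \<noteq> {}"
  proof -
    have "Nm 0 = 0" using Nm unfolding is_norm_def by blast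
    hence "0 \<in> ?B" by (simp add: coord_space_def)
    thus ?thesis by blast
  qed
  ultimately obtain y where y: "y \<in> ?B"
    "\<And>z. z \<in> ?B \<Longrightarrow> (INF x\<in>sol_set A J z. Nn x) \<le> (INF x\<in>sol_set A J y. Nn x)"
    using continuous_attains_sup[OF _ _
        continuous_on_subset[OF least_norm_continuous[OF Nn J] subset_UNIV], of ?B] by blast
  have "hoffman_set Nn Nm A L J = (INF x\<in>sol_set A J y. Nn x)"
    unfolding hoffman_set_def using y by (intro cSup_eq_maximum) auto
  with y that[of y] show ?thesis by simp
qed

lemma hoffman_set_nonneg:
  assumes "is_norm Nn" "is_norm Nm" "A_surjective A J"
  shows "0 \<le> hoffman_set Nn Nm A L J"
proof -
  obtain y where y: "(INF x\<in>sol_set A J y. Nn x) = hoffman_set Nn Nm A L J"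
    using hoffman_set_attained[OF assms] by blast
  obtain x where "Nn x = (INF x\<in>sol_set A J y. Nn x)"
    using sol_set_least_norm[OF assms(1,3)] by blast
  with y show ?thesis using assms(1) unfolding is_norm_def by metis
qed

text \<open>The defining bound on the unit ball extends to all right-hand sides by homogeneity.\<close>

lemma sol_set_short_solution:
  fixes A :: "real ^ 'n ^ 'm"
  assumes Nn: "is_norm Nn" and Nm: "is_norm Nm" and J: "A_surjective A J"
    and y: "y \<in> coord_space L"
  obtains x where "x \<in> sol_set A J y" "Nn x \<le> hoffman_set Nn Nm A L J * Nm y"
proof (cases "y = 0")
  case True
  have "Nn 0 = 0" "Nm 0 = 0" using Nn Nm unfolding is_norm_def by blast+
  with True show ?thesis by (intro that[of 0]) (auto simp: sol_set_iff)
next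
  case False
  hence pos: "Nm y > 0" using Nm unfolding is_norm_def by (metis order_le_less)
  let ?z = "(1 / Nm y) *\<^sub>R y"
  have "Nm ?z = \<bar>1 / Nm y\<bar> * Nm y" using Nm unfolding is_norm_def by blast
  hence "Nm ?z = 1" using pos by simp
  moreover have "?z \<in> coord_space L" using y by (simp add: coord_space_def)
  ultimately have "(INF x\<in>sol_set A J ?z. Nn x) \<le> hoffman_set Nn Nm A L J"
    using hoffman_set_attained[OF Nn Nm J] by (metis order_refl)
  then obtain x where x: "x \<in> sol_set A J ?z" "Nn x \<le> hoffman_set Nn Nm A L J"
    using sol_set_least_norm[OF Nn J] by metis
  show ?thesis
  proof
    show "Nm y *\<^sub>R x \<in> sol_set A J y"
      using x(1) pos by (auto simp: sol_set_iff matrix_vector_mult_scaleR field_simps)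
    have "Nn (Nm y *\<^sub>R x) = Nm y * Nn x" using Nn pos unfolding is_norm_def by simp
    also have "\<dots> \<le> hoffman_set Nn Nm A L J * Nm y" using x(2) pos by simp
    finally show "Nn (Nm y *\<^sub>R x) \<le> hoffman_set Nn Nm A L J * Nm y" .
  qed
qed

lemma hoffman_set_le_hoffman:
  assumes "A_surjective A J"
  shows "hoffman_set Nn Nm A L J \<le> hoffman Nn Nm A L"
  unfolding hoffman_def surjective_sets_def using assms by (intro Max_ge) auto

lemma A_surjective_empty: "A_surjective A {}"
  by (rule A_surjective_if_strictly_feasible) simp

lemma hoffman_attained:
  obtains J where "A_surjective A J" "hoffman Nn Nm A L = hoffman_set Nn Nm A L J"
proof -
  have "hoffman Nn Nm A L \<in> hoffman_set Nn Nm A L ` surjective_sets A"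
    unfolding hoffman_def using A_surjective_empty
    by (intro Max_in) (auto simp: surjective_sets_def)
  thus ?thesis using that by (auto simp: surjective_sets_def)
qed

lemma hoffman_nonneg:
  assumes "is_norm Nn" "is_norm Nm"
  shows "0 \<le> hoffman Nn Nm A L"
  using hoffman_attained hoffman_set_nonneg[OF assms] by metis

section \<open>Certificates with surjective support\<close>

text \<open>Removing from \<open>v\<close> the largest admissible multiple of \<open>w\<close> annihilates a coordinate.\<close>

lemma nonneg_support_reduction:
  fixes v w :: "real ^ 'm"
  assumes v: "0 \<le> v" and w: "0 \<le> w" "w \<noteq> 0" "\<And>i. v $ i = 0 \<Longrightarrow> w $ i = 0"
  obtains t where "0 \<le> t" "0 \<le> v - t *\<^sub>R w" "{i. (v - t *\<^sub>R w) $ i \<noteq> 0} \<subset> {i. v $ i \<noteq> 0}"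
proof -
  define I where "I = {i. w $ i > 0}"
  have w0: "w $ i = 0" if "i \<notin> I" for i
    using that w(1) by (force simp: I_def less_eq_vec_def order_le_less)
  have "I \<noteq> {}" using w(2) w0 by (auto simp: vec_eq_iff)
  define t where "t = Min ((\<lambda>i. v $ i / w $ i) ` I)"
  have "t \<in> (\<lambda>i. v $ i / w $ i) ` I"
    unfolding t_def using \<open>I \<noteq> {}\<close> by (intro Min_in) auto
  then obtain k where k: "k \<in> I" "t = v $ k / w $ k" by blast
  have tle: "t * w $ i \<le> v $ i" if "i \<in> I" for i
  proof -
    have "t \<le> v $ i / w $ i" unfolding t_def using that by (intro Min_le) auto
    thus ?thesis using that by (simp add: I_def field_simps)
  qed
  have vk: "v $ k \<noteq> 0" using w(3)[of k] k(1) by (auto simp: I_def)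
  show ?thesis
  proof
    show "0 \<le> t" using k v w(1) by (auto simp: less_eq_vec_def)
    show "0 \<le> v - t *\<^sub>R w" using tle w0 v by (force simp: less_eq_vec_def)
    have "{i. (v - t *\<^sub>R w) $ i \<noteq> 0} \<subseteq> {i. v $ i \<noteq> 0} - {k}"
      using w(3) k by (auto simp: I_def)
    thus "{i. (v - t *\<^sub>R w) $ i \<noteq> 0} \<subset> {i. v $ i \<noteq> 0}" using vk by blast
  qed
qed

text \<open>Strict separation is essential: a weak certificate could shrink to the zero vector,
  which certifies nothing. Solvability of \<open>A x \<le> c\<close> makes \<open>w \<bullet> c\<close> nonnegative for every
  \<open>w \<ge> 0\<close> annihilating the range of \<open>A\<close>, so that subtracting \<open>w\<close> does not spoil the
  inequality.\<close>

lemma surjective_infeasibility_certificate: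
  fixes A :: "real ^ 'n ^ 'm"
  assumes K: "compact K" "convex K" "K \<noteq> {}"
    and feasible: "polyhedron_of A c \<noteq> {}" and disjoint: "K \<inter> polyhedron_of A c = {}"
  obtains v where "0 \<le> v" "A_surjective A {i. v $ i \<noteq> 0}" "\<And>x. x \<in> K \<Longrightarrow> v \<bullet> c < v \<bullet> (A *v x)"
proof -
  define certificate where
    "certificate v \<longleftrightarrow> 0 \<le> v \<and> (\<forall>x\<in>K. v \<bullet> c < v \<bullet> (A *v x))" for v :: "real ^ 'm"
  have "compact ((*v) A ` K)"
    by (intro compact_continuous_image K linear_continuous_on matrix_vector_mul_bounded_linear)
  moreover have "convex ((*v) A ` K)"
    by (intro convex_linear_image matrix_vector_mul_linear K)
  moreover have "closed {z. z \<le> c}"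
  proof -
    have "{z. z \<le> c} = (\<Inter>i. {z. z $ i \<le> c $ i})" by (auto simp: less_eq_vec_def)
    also have "closed \<dots>" by (intro closed_INT ballI closed_Collect_le continuous_intros)
    finally show ?thesis .
  qed
  moreover have "convex {z. z \<le> c}"
    unfolding convex_def less_eq_vec_def
    by (auto intro!: convex_bound_le)
  moreover have "(*v) A ` K \<inter> {z. z \<le> c} = {}"
    using disjoint by (auto simp: polyhedron_of_def)
  ultimately obtain a \<beta> where a: "\<And>z. z \<in> (*v) A ` K \<Longrightarrow> a \<bullet> z < \<beta>"
    "\<And>z. z \<le> c \<Longrightarrow> a \<bullet> z > \<beta>"
    using separating_hyperplane_compact_closed[of "(*v) A ` K" "{z. z \<le> c}"] K(3) by auto
  have "certificate (- a)"
    unfolding certificate_def less_eq_vec_def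
  proof (intro conjI allI ballI)
    fix i
    have "- a $ i \<ge> 0"
    proof (rule nonneg_if_bdd_below_on_ray)
      fix t :: real assume "t > 0"
      hence "c - axis i t \<le> c" by (auto simp: less_eq_vec_def axis_def)
      from a(2)[OF this] show "\<beta> \<le> a \<bullet> c + t * (- a $ i)"
        by (simp add: inner_diff_right inner_axis mult.commute)
    qed
    thus "0 $ i \<le> (- a) $ i" by simp
  next
    fix x assume "x \<in> K"
    hence "a \<bullet> (A *v x) < \<beta>" by (intro a) auto
    with a(2)[of c] show "- a \<bullet> c < - a \<bullet> (A *v x)" by simp
  qed
  then obtain v where v: "certificate v"
    "\<And>v'. certificate v' \<Longrightarrow> card {i. v $ i \<noteq> 0} \<le> card {i. v' $ i \<noteq> 0}"
    using ex_has_least_nat[of certificate "- a" "\<lambda>v. card {i. v $ i \<noteq> 0}"] by blast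
  have "A_surjective A {i. v $ i \<noteq> 0}"
  proof (rule ccontr)
    assume "\<not> A_surjective A {i. v $ i \<noteq> 0}"
    then obtain w where w: "w \<noteq> 0" "0 \<le> w" "\<And>i. v $ i = 0 \<Longrightarrow> w $ i = 0"
      "\<And>x. w \<bullet> (A *v x) = 0"
      using not_A_surjective_multiplier[of A "{i. v $ i \<noteq> 0}"] by auto
    have "0 \<le> v" using v(1) by (simp add: certificate_def)
    then obtain t where t: "0 \<le> t" "0 \<le> v - t *\<^sub>R w"
      "{i. (v - t *\<^sub>R w) $ i \<noteq> 0} \<subset> {i. v $ i \<noteq> 0}"
      using nonneg_support_reduction[of v w] w by blast
    obtain x0 where x0: "x0 \<in> polyhedron_of A c" using feasible by blast
    have "w \<bullet> (A *v x0) \<le> w \<bullet> c"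
      unfolding inner_vec_def using w(2) x0
      by (intro sum_mono) (auto simp: less_eq_vec_def polyhedron_of_iff intro!: mult_left_mono)
    hence "t * (w \<bullet> c) \<ge> 0" using t(1) w(4) by simp
    hence "certificate (v - t *\<^sub>R w)"
      using v(1) t(2) w(4) by (auto simp: certificate_def inner_diff_left intro: le_less_trans)
    from v(2)[OF this] psubset_card_mono[OF _ t(3)] show False by simp
  qed
  with v(1) that show ?thesis by (auto simp: certificate_def)
qed

section \<open>The error bounds and their tightness\<close>

text \<open>The support \<open>J\<close> of the certificate depends on \<open>y\<close> and \<open>c\<close>; this is why the constant is the
  maximum over all surjective sets.\<close>

lemma short_solution:
  fixes A :: "real ^ 'n ^ 'm"
  assumes Nn: "is_norm Nn" and Nm: "is_norm Nm"
    and y: "y \<in> coord_space L" and c: "y \<le> c" and feasible: "polyhedron_of A c \<noteq> {}"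
  obtains x where "x \<in> polyhedron_of A c" "Nn x \<le> hoffman Nn Nm A L * Nm y"
proof (rule ccontr)
  assume "\<not> thesis"
  define K where "K = {x. Nn x \<le> hoffman Nn Nm A L * Nm y}"
  have Nm_nonneg: "Nm z \<ge> 0" for z using Nm unfolding is_norm_def by blast
  have "compact K" unfolding K_def by (rule is_norm_compact_cball[OF Nn])
  moreover have "convex K"
  proof (rule convexI)
    fix x z and s t :: real
    assume "x \<in> K" "z \<in> K" and st: "0 \<le> s" "0 \<le> t" "s + t = 1"
    hence "s * Nn x + t * Nn z \<le> hoffman Nn Nm A L * Nm y"
      by (intro convex_bound_le) (auto simp: K_def)
    with is_norm_convex_combination[OF Nn st(1,2), of x z] show "s *\<^sub>R x + t *\<^sub>R z \<in> K"
      by (simp add: K_def)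
  qed
  moreover have "K \<noteq> {}"
  proof -
    have "Nn 0 = 0" using Nn unfolding is_norm_def by blast
    hence "0 \<in> K" using hoffman_nonneg[OF Nn Nm] Nm_nonneg by (simp add: K_def)
    thus ?thesis by blast
  qed
  moreover have "K \<inter> polyhedron_of A c = {}" using that \<open>\<not> thesis\<close> by (auto simp: K_def)
  ultimately obtain v where v: "0 \<le> v" "A_surjective A {i. v $ i \<noteq> 0}"
    "\<And>x. x \<in> K \<Longrightarrow> v \<bullet> c < v \<bullet> (A *v x)"
    using surjective_infeasibility_certificate feasible by blast
  obtain x where x: "x \<in> sol_set A {i. v $ i \<noteq> 0} y"
    "Nn x \<le> hoffman_set Nn Nm A L {i. v $ i \<noteq> 0} * Nm y"
    using sol_set_short_solution[OF Nn Nm v(2) y] by blast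
  have "x \<in> K"
    using x(2) mult_right_mono[OF hoffman_set_le_hoffman[OF v(2)] Nm_nonneg]
    unfolding K_def by (auto intro: order_trans)
  moreover have "v \<bullet> (A *v x) \<le> v \<bullet> c"
    unfolding inner_vec_def
  proof (rule sum_mono)
    fix i
    show "v $ i \<bullet> (A *v x) $ i \<le> v $ i \<bullet> c $ i"
    proof (cases "v $ i = 0")
      case False
      hence "(A *v x) $ i \<le> y $ i" using x(1) by (simp add: sol_set_iff)
      also have "\<dots> \<le> c $ i" using c by (simp add: less_eq_vec_def)
      finally show ?thesis using v(1) by (simp add: less_eq_vec_def mult_left_mono)
    qed simp
  qed
  ultimately show False using v(3) by fastforce
qed

lemma subvec_compl_eq_0_iff: "subvec (- L) z = 0 \<longleftrightarrow> z \<in> coord_space L"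
  by (auto simp: subvec_def coord_space_def vec_eq_iff)

lemma dist_on_le:
  assumes "is_norm Nm" "0 \<le> s" "b - (A *v u + s) \<in> coord_space L"
  shows "dist_on Nm L b {A *v u + s | s. 0 \<le> s} \<le> Nm (b - (A *v u + s))"
  unfolding dist_on_def
  using assms is_norm_bdd_below[OF assms(1), of "\<lambda>y. b - y"]
  by (intro cINF_lower) (auto simp: subvec_compl_eq_0_iff)

text \<open>Off \<open>L\<close> the slack of \<open>u\<close> is already nonnegative, so only the violation in the rows of \<open>L\<close>
  has to be added to it. Besides giving the second bound, this shows that the infimum in
  \<^const>\<open>dist_on\<close> ranges over a nonempty set.\<close>

lemma residual_decomposition:
  fixes A :: "real ^ 'n ^ 'm"
  assumes "u \<in> sol_set A (- L) b"
  obtains s where "0 \<le> s"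
    "b - (A *v u + s) = - pos_part_vec (subvec L (A *v u) - subvec L b)"
    "b - (A *v u + s) \<in> coord_space L"
proof
  let ?s = "b - A *v u + pos_part_vec (subvec L (A *v u) - subvec L b)"
  show "0 \<le> ?s"
    using assms by (auto simp: less_eq_vec_def pos_part_vec_def subvec_def sol_set_iff)
  show "b - (A *v u + ?s) = - pos_part_vec (subvec L (A *v u) - subvec L b)" by simp
  show "b - (A *v u + ?s) \<in> coord_space L"
    by (simp add: coord_space_def pos_part_vec_def subvec_def)
qed

lemma dist_to_polyhedron_le:
  fixes A :: "real ^ 'n ^ 'm"
  assumes Nn: "is_norm Nn" and Nm: "is_norm Nm"
    and feasible: "polyhedron_of A b \<noteq> {}" and u: "u \<in> sol_set A (- L) b"
  shows "dist_to Nn u (polyhedron_of A b)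
    \<le> hoffman Nn Nm A L * dist_on Nm L b {A *v u + s | s. 0 \<le> s}"
proof -
  let ?H = "hoffman Nn Nm A L"
  let ?Y = "{y \<in> {A *v u + s | s. 0 \<le> s}. subvec (- L) (b - y) = 0}"
  let ?d = "dist_to Nn u (polyhedron_of A b)"
  have bound: "?d \<le> ?H * Nm (b - y)" if "y \<in> ?Y" for y
  proof -
    obtain s where s: "y = A *v u + s" "0 \<le> s" "b - y \<in> coord_space L"
      using \<open>y \<in> ?Y\<close> by (auto simp: subvec_compl_eq_0_iff)
    have shift: "x \<in> polyhedron_of A (b - A *v u) \<longleftrightarrow> u + x \<in> polyhedron_of A b" for x
      by (simp add: polyhedron_of_iff matrix_vector_right_distrib le_diff_eq add.commute)
    obtain x0 where "x0 \<in> polyhedron_of A b" using feasible by blast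
    hence "x0 - u \<in> polyhedron_of A (b - A *v u)" by (simp add: shift)
    moreover have "b - y \<le> b - A *v u" using s(1,2) by (simp add: less_eq_vec_def)
    ultimately obtain x where x: "x \<in> polyhedron_of A (b - A *v u)" "Nn x \<le> ?H * Nm (b - y)"
      using short_solution[OF Nn Nm s(3)] by blast
    have "?d \<le> Nn (u - (u + x))"
      unfolding dist_to_def using x(1) is_norm_bdd_below[OF Nn]
      by (intro cINF_lower) (auto simp: shift)
    also have "\<dots> = Nn x" by (simp add: is_norm_minus[OF Nn])
    finally show ?thesis using x(2) by simp
  qed
  obtain s where "0 \<le> s" "b - (A *v u + s) \<in> coord_space L"
    by (rule residual_decomposition[OF u])
  hence ne: "?Y \<noteq> {}" unfolding subvec_compl_eq_0_iff by blast
  \<comment> \<open>Passing to the infimum over \<open>y\<close> divides by \<open>H\<close>, hence the case distinction.\<close>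
  show ?thesis
  proof (cases "?H = 0")
    case True
    obtain y where "y \<in> ?Y" using ne by blast
    from bound[OF this] True show ?thesis by simp
  next
    case False
    hence pos: "?H > 0" using hoffman_nonneg[OF Nn Nm, of A L] by simp
    have "?d / ?H \<le> dist_on Nm L b {A *v u + s | s. 0 \<le> s}"
      unfolding dist_on_def
    proof (rule cINF_greatest[OF ne])
      fix y assume "y \<in> ?Y"
      from bound[OF this] show "?d / ?H \<le> Nm (b - y)" using pos by (simp add: field_simps)
    qed
    thus ?thesis using pos by (simp add: field_simps)
  qed
qed

lemma dist_on_le_residual:
  fixes A :: "real ^ 'n ^ 'm"
  assumes Nm: "is_norm Nm" and u: "u \<in> sol_set A (- L) b"
  shows "dist_on Nm L b {A *v u + s | s. 0 \<le> s}
    \<le> Nm (pos_part_vec (subvec L (A *v u) - subvec L b))"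
proof -
  obtain s where s: "0 \<le> s"
    "b - (A *v u + s) = - pos_part_vec (subvec L (A *v u) - subvec L b)"
    "b - (A *v u + s) \<in> coord_space L"
    by (rule residual_decomposition[OF u])
  from dist_on_le[OF Nm s(1,3)] show ?thesis by (simp only: s(2) is_norm_minus[OF Nm])
qed

text \<open>Lemma \<open>dist_to_polyhedron_le\<close> does half of the work: in the extremal instance the distance on the
  left is exactly \<open>H\<close> and the one on the right is at most \<open>1\<close>, so the lemma forces equality.\<close>

lemma hoffman_bound_tight:
  fixes A :: "real ^ 'n ^ 'm"
  assumes Nn: "is_norm Nn" and Nm: "is_norm Nm" and pos: "hoffman Nn Nm A L > 0"
  obtains b u where "polyhedron_of A b \<noteq> {}" "u \<in> sol_set A (- L) b - polyhedron_of A b"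
    "dist_to Nn u (polyhedron_of A b)
      = hoffman Nn Nm A L * dist_on Nm L b {A *v u + s | s. 0 \<le> s}"
proof -
  let ?H = "hoffman Nn Nm A L"
  obtain J where J: "A_surjective A J" "?H = hoffman_set Nn Nm A L J"
    by (rule hoffman_attained)
  obtain y where y: "y \<in> coord_space L" "Nm y \<le> 1" "(INF x\<in>sol_set A J y. Nn x) = ?H"
    using hoffman_set_attained[OF Nn Nm J(1)] J(2) by metis
  obtain x where x: "x \<in> sol_set A J y" "Nn x = ?H"
    using sol_set_least_norm[OF Nn J(1)] y(3) by metis
  define b where "b = (\<chi> i. if i \<in> J then y $ i else \<bar>y $ i\<bar> + \<bar>(A *v x) $ i\<bar>)"
  let ?P = "polyhedron_of A b"
  \<comment> \<open>Off \<open>J\<close>, the first summand of \<open>b\<close> keeps \<open>b - y\<close> nonnegative and the second keeps \<open>x\<close> feasible.\<close>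
  have xP: "x \<in> ?P" using x(1) by (auto simp: b_def polyhedron_of_iff sol_set_iff intro: add_increasing)
  have "?P \<subseteq> sol_set A J y"
  proof
    fix z assume "z \<in> ?P"
    hence *: "(A *v z) $ i \<le> b $ i" for i by (simp add: polyhedron_of_iff)
    show "z \<in> sol_set A J y"
      unfolding sol_set_iff
    proof
      fix i assume "i \<in> J"
      thus "(A *v z) $ i \<le> y $ i" using *[of i] by (simp add: b_def)
    qed
  qed
  hence least: "?H \<le> Nn z" if "z \<in> ?P" for z
    unfolding y(3)[symmetric] using that is_norm_bdd_below[OF Nn, of "\<lambda>x. x"]
    by (intro cINF_lower) auto
  have dist: "dist_to Nn 0 ?P = ?H"
    unfolding dist_to_def using x(2) xP least
    by (intro cInf_eq_minimum) (auto simp: is_norm_minus[OF Nn] intro: image_eqI[of _ _ x])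
  have "Nn 0 = 0" using Nn unfolding is_norm_def by blast
  hence "0 \<notin> ?P" using least[of 0] pos by auto
  moreover have sol: "0 \<in> sol_set A (- L) b"
    using y(1) by (auto simp: sol_set_iff b_def coord_space_def)
  moreover have "dist_on Nm L b {A *v 0 + s | s. 0 \<le> s} \<le> 1"
  proof -
    have "0 \<le> b - y" by (auto simp: b_def less_eq_vec_def)
    from dist_on_le[OF Nm this, of b A 0 L] y(1,2) show ?thesis by simp
  qed
  hence "?H * dist_on Nm L b {A *v 0 + s | s. 0 \<le> s} \<le> ?H" using pos by simp
  moreover have "?P \<noteq> {}" using xP by blast
  ultimately show ?thesis
    using that[of b 0] dist dist_to_polyhedron_le[OF Nn Nm _ sol] by force
qed

theorem proposition3:
  fixes A :: "real ^ 'n ^ 'm"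
    and L :: "'m set"
    and Nn :: "real ^ 'n \<Rightarrow> real"
    and Nm :: "real ^ 'm \<Rightarrow> real"
  assumes "is_norm Nn" and "is_norm Nm"
  shows
    "(\<forall>b. polyhedron_of A b \<noteq> {} \<longrightarrow>
        (\<forall>u \<in> sol_set A (- L) b.
           dist_to Nn u (polyhedron_of A b)
             \<le> hoffman Nn Nm A L * dist_on Nm L b {A *v u + s | s. 0 \<le> s} \<and>
           hoffman Nn Nm A L * dist_on Nm L b {A *v u + s | s. 0 \<le> s}
             \<le> hoffman Nn Nm A L * Nm (pos_part_vec (subvec L (A *v u) - subvec L b)))) \<and>
     (hoffman Nn Nm A L > 0 \<longrightarrow>
        (\<exists>b. polyhedron_of A b \<noteq> {} \<and>
          (\<exists>u \<in> sol_set A (- L) b - polyhedron_of A b.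
             dist_to Nn u (polyhedron_of A b)
               = hoffman Nn Nm A L * dist_on Nm L b {A *v u + s | s. 0 \<le> s})))"
proof (intro conjI allI impI ballI)
  fix b u assume b: "polyhedron_of A b \<noteq> {}" and u: "u \<in> sol_set A (- L) b"
  show "dist_to Nn u (polyhedron_of A b)
      \<le> hoffman Nn Nm A L * dist_on Nm L b {A *v u + s | s. 0 \<le> s}"
    by (rule dist_to_polyhedron_le[OF assms b u])
  show "hoffman Nn Nm A L * dist_on Nm L b {A *v u + s | s. 0 \<le> s}
      \<le> hoffman Nn Nm A L * Nm (pos_part_vec (subvec L (A *v u) - subvec L b))"
    by (intro mult_left_mono dist_on_le_residual hoffman_nonneg assms u)
next
  assume "hoffman Nn Nm A L > 0"
  from hoffman_bound_tight[OF assms this]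
  show "\<exists>b. polyhedron_of A b \<noteq> {} \<and>
      (\<exists>u \<in> sol_set A (- L) b - polyhedron_of A b.
         dist_to Nn u (polyhedron_of A b)
           = hoffman Nn Nm A L * dist_on Nm L b {A *v u + s | s. 0 \<le> s})"
    by blast
qed

end
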